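(* Let $S\ne\mathbb{N}$ be a numerical semigroup with minimal generating set $g_0<g_1<\ldots<g_{e-1}$, conductor $c$, $L=S\cap\{0,\ldots,c-1\}$, and let $g=(g_1,\ldots,g_{e-1})$ and $\gamma=g_0^{-1}g$. Let $\tilde A\subseteq\mathbb{N}^{e-1}$ be the set of LEX-minimal representatives of the Apéry set of $S$ with respect to $g_0$ (see context), and put $n_0:=\lfloor\frac{c-1+g_0}{g_0}\rfloor$. For $n=0,\ldots,n_0$ let $$H_n:=\{x\in\mathbb{N}^{e-1}\mid ng_0\le x\cdot g<(n+1)g_0\},\quad H_n':=\{x\in\mathbb{N}^{e-1}\mid c-1-(n_0-n)g_0<x\cdot g\le c-1-(n_0-n-1)g_0\},$$ $h_n:=\#(\tilde A\cap H_n)$ and $h_n':=\#(\tilde A\cap H_n')$. Then $$n_0=n_0(\gamma,\tilde A),\qquad c+g_0-1=g_0\cdot\max(\tilde A\cdot\gamma),$$ $$H_n=H_n(\gamma),\quad h_n=h_n(\gamma,\tilde A),\quad H_n'=H_n'(\gamma,\tilde A),\quad h_n'=h_n'(\gamma,\tilde A)\qquad(n=0,\ldots,n_0),$$ and $$w(S)=w(\gamma,\tilde A).$$ Hence Wilf's inequality $\frac{\#L}{c}\ge\frac1e$ for $S$ is equivalent to $w(\gamma,\tilde A)\ge\frac{1}{e-1}$.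
   Context: $\mathbb{N}=\{0,1,2,\ldots\}$. A numerical semigroup is $S=\mathbb{N}g_0+\ldots+\mathbb{N}g_{e-1}$ with positive integers $g_i$, $\gcd(g_0,\ldots,g_{e-1})=1$. The conductor is $c=\min\{s\in S\mid s+\mathbb{N}\subseteq S\}$. The Apéry set is $A=\{s\in S\mid s-g_0\notin S\}$; each $a\in A$ can be written $a=x\cdot g$ with $x\in\mathbb{N}^{e-1}$ (dot product). LEX is the lexicographic order on $\mathbb{N}^{e-1}$: $a<_{\mathrm{LEX}}b$ if the leftmost nonzero component of $a-b$ is negative. For $a\in A$ let $\tilde a:=\min_{\mathrm{LEX}}\{x\in\mathbb{N}^{e-1}\mid x\cdot g=a\}$, and $\tilde A:=\{\tilde a\mid a\in A\}$; $\tilde A$ is finite and its complement in $\mathbb{N}^{e-1}$ is closed under adding elements of $\mathbb{N}^{e-1}$. The Wilf ratio of $S$ is $w(S):=\frac{\#L}{\#(\mathbb{N}\setminus S)}$. For $\gamma\in\mathbb{Q}^{e-1}$ with $1\le\gamma_1\le\ldots\le\gamma_{e-1}$ and a finite nonempty $B\subseteq\mathbb{N}^{e-1}$, $B\ne\{0\}$, whose complement $C$ satisfies $C+\mathbb{N}^{e-1}\subseteq C$, put $\max(B\cdot\gamma):=\max\{b\cdot\gamma\mid b\in B\}$, $n_0(\gamma,B):=\lfloor\max(B\cdot\gamma)\rfloor$, and for $n=0,\ldots,n_0(\gamma,B)$: $$H_n(\gamma):=\{x\in\mathbb{N}^{e-1}\mid\lfloor x\cdot\gamma\rfloor=n\},\quad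 h_n(\gamma,B):=\#(B\cap H_n(\gamma)),$$ $$H_n'(\gamma,B):=\{x\in\mathbb{N}^{e-1}\mid n_0(\gamma,B)-\lfloor\max(B\cdot\gamma)-x\cdot\gamma\rfloor=n\},\quad h_n'(\gamma,B):=\#(B\cap H_n'(\gamma,B)).$$ With $N=n_0(\gamma,B)$, the Wilf ratio of $\mathbb{N}^{e-1}\setminus B$ with respect to $\gamma$ is $$w(\gamma,B):=\frac{N\cdot h_0'(\gamma,B)+(N-1)h_1'(\gamma,B)+\ldots+0\cdot h_N'(\gamma,B)}{0\cdot h_0(\gamma,B)+1\cdot h_1(\gamma,B)+\ldots+N\cdot h_N(\gamma,B)}.$$ *)

theory Defs
  imports Complex_Main "HOL-Library.Fun_Lexorder"
begin

section \<open>Numerical semigroups\<close>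

definition generated_by :: "nat set \<Rightarrow> nat set" where
  "generated_by G = {\<Sum>a\<in>G. k a * a | k :: nat \<Rightarrow> nat. True}"

definition numerical_semigroup :: "nat set \<Rightarrow> bool" where
  "numerical_semigroup S \<longleftrightarrow>
     (\<exists>G. finite G \<and> (\<forall>a\<in>G. 0 < a) \<and> Gcd G = 1 \<and> S = generated_by G)"

definition minimal_generating_set :: "nat set \<Rightarrow> nat set \<Rightarrow> bool" where
  "minimal_generating_set G S \<longleftrightarrow>
     finite G \<and> generated_by G = S \<and> (\<forall>G'. G' \<subset> G \<longrightarrow> generated_by G' \<noteq> S)"

definition conductor :: "nat set \<Rightarrow> nat" where
  "conductor S = (LEAST s. s \<in> S \<and> (\<forall>n. s + n \<in> S))"

definition left_elements :: "nat set \<Rightarrow> nat set" where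
  "left_elements S = S \<inter> {0..<conductor S}"

definition wilf_ratio :: "nat set \<Rightarrow> rat" where
  "wilf_ratio S = of_nat (card (left_elements S)) / of_nat (card (UNIV - S))"

definition apery_set :: "nat set \<Rightarrow> nat \<Rightarrow> nat set" where
  "apery_set S m = {s \<in> S. int s - int m \<notin> int ` S}"


section \<open>Vectors indexed by \<open>1, \<dots>, e - 1\<close>\<close>

text \<open>The set of vectors of natural numbers with components \<open>1, \<dots>, e - 1\<close> is encoded by the
  functions that vanish at all other indices, so that equality of functions is equality of vectors.
  The weight \<open>w\<close> in a dot product is only read at the indices \<open>1, \<dots>, e - 1\<close>.\<close>

definition nvecs :: "nat \<Rightarrow> (nat \<Rightarrow> nat) set" where
  "nvecs e = {x. \<forall>i. i \<notin> {1..<e} \<longrightarrow> x i = 0}"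

definition dot :: "nat \<Rightarrow> (nat \<Rightarrow> nat) \<Rightarrow> (nat \<Rightarrow> 'a::semiring_1) \<Rightarrow> 'a" where
  "dot e x w = (\<Sum>i\<in>{1..<e}. of_nat (x i) * w i)"

text \<open>On these vectors LEX is the relation \<^const>\<open>less_fun\<close>: some component is smaller and all
  components at smaller indices agree.\<close>

definition lex_min_rep :: "nat \<Rightarrow> (nat \<Rightarrow> nat) \<Rightarrow> nat \<Rightarrow> nat \<Rightarrow> nat" where
  "lex_min_rep e g a =
     (THE x. x \<in> nvecs e \<and> dot e x g = a \<and>
        (\<forall>y\<in>nvecs e. dot e y g = a \<longrightarrow> x = y \<or> less_fun x y))"

definition lex_apery :: "nat set \<Rightarrow> nat \<Rightarrow> (nat \<Rightarrow> nat) \<Rightarrow> (nat \<Rightarrow> nat) set" where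
  "lex_apery S e g = lex_min_rep e g ` apery_set S (g 0)"


section \<open>The Wilf ratio with respect to a weight vector\<close>

text \<open>The definitions after \<open>admissible_weight\<close> and \<open>admissible_set\<close> are meant for arguments with
  these two properties; the lemmas at the end of the theory show that the weight vector and the set
  of vectors obtained from a numerical semigroup have them.\<close>

definition admissible_weight :: "nat \<Rightarrow> (nat \<Rightarrow> rat) \<Rightarrow> bool" where
  "admissible_weight e \<gamma> \<longleftrightarrow> (\<forall>i\<in>{1..<e}. 1 \<le> \<gamma> i) \<and> mono_on {1..<e} \<gamma>"

definition admissible_set :: "nat \<Rightarrow> (nat \<Rightarrow> nat) set \<Rightarrow> bool" where
  "admissible_set e B \<longleftrightarrow>
     finite B \<and> B \<noteq> {} \<and> B \<noteq> {\<lambda>i. 0} \<and> B \<subseteq> nvecs e \<and>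
     (\<forall>x\<in>nvecs e - B. \<forall>y\<in>nvecs e. (\<lambda>i. x i + y i) \<in> nvecs e - B)"

definition max_dot :: "nat \<Rightarrow> (nat \<Rightarrow> rat) \<Rightarrow> (nat \<Rightarrow> nat) set \<Rightarrow> rat" where
  "max_dot e \<gamma> B = Max ((\<lambda>b. dot e b \<gamma>) ` B)"

definition top_level :: "nat \<Rightarrow> (nat \<Rightarrow> rat) \<Rightarrow> (nat \<Rightarrow> nat) set \<Rightarrow> int" where
  "top_level e \<gamma> B = \<lfloor>max_dot e \<gamma> B\<rfloor>"

definition level :: "nat \<Rightarrow> (nat \<Rightarrow> rat) \<Rightarrow> int \<Rightarrow> (nat \<Rightarrow> nat) set" where
  "level e \<gamma> n = {x \<in> nvecs e. \<lfloor>dot e x \<gamma>\<rfloor> = n}"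

definition level_card :: "nat \<Rightarrow> (nat \<Rightarrow> rat) \<Rightarrow> (nat \<Rightarrow> nat) set \<Rightarrow> int \<Rightarrow> nat" where
  "level_card e \<gamma> B n = card (B \<inter> level e \<gamma> n)"

definition level' :: "nat \<Rightarrow> (nat \<Rightarrow> rat) \<Rightarrow> (nat \<Rightarrow> nat) set \<Rightarrow> int \<Rightarrow> (nat \<Rightarrow> nat) set" where
  "level' e \<gamma> B n =
     {x \<in> nvecs e. top_level e \<gamma> B - \<lfloor>max_dot e \<gamma> B - dot e x \<gamma>\<rfloor> = n}"

definition level_card' :: "nat \<Rightarrow> (nat \<Rightarrow> rat) \<Rightarrow> (nat \<Rightarrow> nat) set \<Rightarrow> int \<Rightarrow> nat" where
  "level_card' e \<gamma> B n = card (B \<inter> level' e \<gamma> B n)"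

definition weighted_wilf_ratio :: "nat \<Rightarrow> (nat \<Rightarrow> rat) \<Rightarrow> (nat \<Rightarrow> nat) set \<Rightarrow> rat" where
  "weighted_wilf_ratio e \<gamma> B =
     (\<Sum>n\<in>{0..top_level e \<gamma> B}. of_int (top_level e \<gamma> B - n) * of_nat (level_card' e \<gamma> B n)) /
     (\<Sum>n\<in>{0..top_level e \<gamma> B}. of_int n * of_nat (level_card e \<gamma> B n))"


section \<open>Admissibility of the data obtained from a numerical semigroup\<close>

lemma dot_add: "dot e (\<lambda>i. x i + y i) w = dot e x w + dot e y w"
  by (simp add: dot_def algebra_simps sum.distrib)

lemma nvecs_add: "x \<in> nvecs e \<Longrightarrow> y \<in> nvecs e \<Longrightarrow> (\<lambda>i. x i + y i) \<in> nvecs e"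
  by (simp add: nvecs_def)

lemma generated_by_add:
  assumes "a \<in> generated_by G" "b \<in> generated_by G"
  shows "a + b \<in> generated_by G"
proof -
  from assms obtain k l where "a = (\<Sum>x\<in>G. k x * x)" "b = (\<Sum>x\<in>G. l x * x)"
    by (auto simp: generated_by_def)
  then have "a + b = (\<Sum>x\<in>G. (k x + l x) * x)"
    by (simp add: sum.distrib algebra_simps)
  then show ?thesis unfolding generated_by_def by (intro CollectI exI[of _ "\<lambda>x. k x + l x"]) simp
qed

lemma generated_by_zero: "0 \<in> generated_by G"
  unfolding generated_by_def by (intro CollectI exI[of _ "\<lambda>_. 0"]) simp

lemma generated_by_mem:
  assumes "finite G" "a \<in> G"
  shows "a \<in> generated_by G"
proof -
  have "(\<Sum>x\<in>G. (if x = a then 1 else 0) * x) = (\<Sum>x\<in>G. if x = a then x else 0)"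
    by (rule sum.cong) auto
  also have "\<dots> = a" using assms by simp
  finally have "a = (\<Sum>x\<in>G. (if x = a then 1 else 0) * x)" by simp
  then show ?thesis unfolding generated_by_def
    by (intro CollectI exI[of _ "\<lambda>x. if x = a then 1 else 0"]) simp
qed

lemma generated_by_dvd:
  assumes "\<forall>a\<in>G. d dvd a" "s \<in> generated_by G"
  shows "d dvd s"
  using assms by (auto simp: generated_by_def intro!: dvd_sum)

locale semigroup_setup =
  fixes S :: "nat set" and e :: nat and g :: "nat \<Rightarrow> nat"
  assumes numerical: "numerical_semigroup S"
    and proper: "S \<noteq> UNIV"
    and strict: "strict_mono_on {..<e} g"
    and minimal: "minimal_generating_set (g ` {..<e}) S"
begin

lemma add_mem: "a \<in> S \<Longrightarrow> b \<in> S \<Longrightarrow> a + b \<in> S"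
  using numerical generated_by_add by (auto simp: numerical_semigroup_def)

lemma zero_mem: "0 \<in> S"
  using numerical generated_by_zero by (auto simp: numerical_semigroup_def)

lemma mult_mem: "a \<in> S \<Longrightarrow> k * a \<in> S"
  by (induction k) (auto simp: add_mem zero_mem)

lemma gen_mem: "i < e \<Longrightarrow> g i \<in> S"
  using minimal generated_by_mem[of "g ` {..<e}" "g i"] by (auto simp: minimal_generating_set_def)

lemma common_divisor:
  assumes "\<forall>s\<in>S. d dvd s"
  shows "d = 1"
proof -
  from numerical obtain G where G: "finite G" "Gcd G = 1" "S = generated_by G"
    by (auto simp: numerical_semigroup_def)
  then have "\<forall>a\<in>G. d dvd a" using assms generated_by_mem by blast
  then have "d dvd Gcd G" by (simp add: Gcd_greatest)
  then show ?thesis using G by simp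
qed

lemma gen_pos:
  assumes "i < e"
  shows "0 < g i"
proof (rule ccontr)
  assume "\<not> 0 < g i"
  then have gi: "g i = 0" by simp
  let ?G = "g ` {..<e}"
  have "generated_by (?G - {0}) = generated_by ?G"
  proof -
    have "(\<Sum>a\<in>?G - {0}. k a * a) = (\<Sum>a\<in>?G. k a * a)" for k :: "nat \<Rightarrow> nat"
      by (rule sum.mono_neutral_left) auto
    then show ?thesis by (simp add: generated_by_def)
  qed
  moreover have "?G - {0} \<subset> ?G" using gi assms by (force simp: image_iff)
  ultimately show False using minimal unfolding minimal_generating_set_def by blast
qed

lemma e_pos: "0 < e"
proof (rule ccontr)
  assume "\<not> 0 < e"
  then have "S = {0}" using minimal by (auto simp: minimal_generating_set_def generated_by_def)
  then have "(2::nat) = 1" by (intro common_divisor) auto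
  then show False by simp
qed

lemma dot_mem: "dot e x g \<in> S"
proof -
  have "finite I \<Longrightarrow> I \<subseteq> {1..<e} \<Longrightarrow> (\<Sum>i\<in>I. x i * g i) \<in> S" for I
    by (induction I rule: finite_induct) (auto simp: zero_mem intro!: add_mem mult_mem gen_mem)
  then show ?thesis by (auto simp: dot_def)
qed

lemma mem_decompose:
  assumes "s \<in> S"
  obtains k x where "x \<in> nvecs e" "s = k * g 0 + dot e x g"
proof -
  have inj: "inj_on g {..<e}" using strict by (rule strict_mono_on_imp_inj_on)
  from assms minimal obtain k where "s = (\<Sum>a\<in>g ` {..<e}. k a * a)"
    by (auto simp: minimal_generating_set_def generated_by_def)
  then have "s = (\<Sum>i<e. k (g i) * g i)" by (simp add: sum.reindex[OF inj])
  also have "\<dots> = k (g 0) * g 0 + (\<Sum>i\<in>{1..<e}. k (g i) * g i)"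
    using e_pos by (simp add: lessThan_atLeast0 sum.atLeast_Suc_lessThan)
  also have "(\<Sum>i\<in>{1..<e}. k (g i) * g i) = dot e (\<lambda>i. if i \<in> {1..<e} then k (g i) else 0) g"
    unfolding dot_def by (rule sum.cong) auto
  finally show thesis by (intro that) (auto simp: nvecs_def)
qed

lemma apery_iff: "a \<in> apery_set S (g 0) \<longleftrightarrow> a \<in> S \<and> (\<forall>t\<in>S. a \<noteq> t + g 0)"
  by (auto simp: apery_set_def image_iff)

lemma apery_rep:
  assumes "a \<in> apery_set S (g 0)"
  obtains x where "x \<in> nvecs e" "dot e x g = a"
proof -
  from assms have "a \<in> S" by (simp add: apery_iff)
  then obtain k x where x: "x \<in> nvecs e" "a = k * g 0 + dot e x g" by (rule mem_decompose)
  have "k = 0"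
  proof (rule ccontr)
    assume "k \<noteq> 0"
    then obtain j where "k = Suc j" by (cases k) auto
    then have "a = (j * g 0 + dot e x g) + g 0" using x by simp
    moreover have "j * g 0 + dot e x g \<in> S" by (intro add_mem mult_mem gen_mem e_pos dot_mem)
    ultimately show False using assms by (auto simp: apery_iff)
  qed
  then show thesis using x that by simp
qed

lemma finite_reps: "finite {x \<in> nvecs e. dot e x g \<le> m}"
proof (rule finite_subset)
  show "finite {x. \<forall>i. (i \<in> {1..<e} \<longrightarrow> x i \<in> {..m}) \<and> (i \<notin> {1..<e} \<longrightarrow> x i = 0)}"
    by (rule finite_set_of_finite_funs) auto
  have "x i \<le> m" if x: "dot e x g \<le> m" and i: "i \<in> {1..<e}" for x i
  proof -
    have "x i \<le> x i * g i" using gen_pos[of i] i by simp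
    also have "\<dots> \<le> dot e x g"
      using member_le_sum[of i "{1..<e}" "\<lambda>i. x i * g i"] i by (simp add: dot_def)
    finally show ?thesis using x by simp
  qed
  then show "{x \<in> nvecs e. dot e x g \<le> m} \<subseteq>
      {x. \<forall>i. (i \<in> {1..<e} \<longrightarrow> x i \<in> {..m}) \<and> (i \<notin> {1..<e} \<longrightarrow> x i = 0)}"
    by (auto simp: nvecs_def)
qed

lemma lex_min_rep:
  assumes "a \<in> apery_set S (g 0)"
  shows "lex_min_rep e g a \<in> nvecs e" "dot e (lex_min_rep e g a) g = a"
    "\<And>y. y \<in> nvecs e \<Longrightarrow> dot e y g = a \<Longrightarrow> lex_min_rep e g a = y \<or> less_fun (lex_min_rep e g a) y"
proof -
  let ?R = "{x \<in> nvecs e. dot e x g = a}"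
  let ?P = "\<lambda>x. x \<in> nvecs e \<and> dot e x g = a \<and>
        (\<forall>y\<in>nvecs e. dot e y g = a \<longrightarrow> x = y \<or> less_fun x y)"
  have fin: "finite ?R" by (rule finite_subset[OF _ finite_reps[of a]]) auto
  have ne: "?R \<noteq> {}" using apery_rep[OF assms] by blast
  have tri: "less_fun x y \<or> x = y \<or> less_fun y x" if "x \<in> nvecs e" "y \<in> nvecs e"
    for x y :: "nat \<Rightarrow> nat"
  proof (rule less_fun_trichotomy)
    have "{i. x i \<noteq> y i} \<subseteq> {1..<e}" using that by (force simp: nvecs_def)
    then show "finite {i. x i \<noteq> y i}" by (rule finite_subset) simp
  qed
  have ex: "\<exists>x\<in>F. \<forall>y\<in>F. x = y \<or> less_fun x y"
    if "finite F" "F \<noteq> {}" "F \<subseteq> nvecs e" for F :: "(nat \<Rightarrow> nat) set"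
    using that
  proof (induction F rule: finite_ne_induct)
    case (insert z F)
    then obtain x where x: "x \<in> F" "\<forall>y\<in>F. x = y \<or> less_fun x y" by auto
    then have "x \<in> nvecs e" "z \<in> nvecs e" using insert.prems by auto
    then consider "less_fun z x" | "z = x \<or> less_fun x z" using tri[of x z] by blast
    then show ?case
    proof cases
      case 1
      then have "less_fun z y" if "y \<in> F" for y
        using x(2) that less_fun_trans[of z x y] by (cases "x = y") auto
      then show ?thesis by blast
    next
      case 2
      then have "\<forall>y\<in>insert z F. x = y \<or> less_fun x y" using x(2) by blast
      then show ?thesis using x(1) by blast
    qed
  qed simp
  have "?R \<subseteq> nvecs e" by blast
  from ex[OF fin ne this] obtain x where x: "?P x" by blast
  have "?P (lex_min_rep e g a)" unfolding lex_min_rep_def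
  proof (rule theI[of ?P, OF x])
    fix y assume "?P y"
    then show "y = x" using x less_fun_asym by blast
  qed
  then show "lex_min_rep e g a \<in> nvecs e" "dot e (lex_min_rep e g a) g = a"
    "\<And>y. y \<in> nvecs e \<Longrightarrow> dot e y g = a \<Longrightarrow> lex_min_rep e g a = y \<or> less_fun (lex_min_rep e g a) y"
    by blast+
qed

lemma lex_apery_iff:
  "x \<in> lex_apery S e g \<longleftrightarrow> x \<in> nvecs e \<and> dot e x g \<in> apery_set S (g 0) \<and>
     (\<forall>y\<in>nvecs e. dot e y g = dot e x g \<longrightarrow> x = y \<or> less_fun x y)"
  (is "_ \<longleftrightarrow> ?R")
proof
  assume "x \<in> lex_apery S e g"
  then obtain a where a: "a \<in> apery_set S (g 0)" "x = lex_min_rep e g a"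
    by (auto simp: lex_apery_def)
  note rep = lex_min_rep[OF a(1), folded a(2)]
  have "x = y \<or> less_fun x y" if "y \<in> nvecs e" "dot e y g = dot e x g" for y
    using rep(3)[OF that(1)] that(2) rep(2) by simp
  then show ?R using rep(1,2) a(1) by simp
next
  assume x: ?R
  note rep = lex_min_rep[of "dot e x g"]
  have "x = lex_min_rep e g (dot e x g)"
  proof (rule ccontr)
    assume "x \<noteq> lex_min_rep e g (dot e x g)"
    then have "less_fun x (lex_min_rep e g (dot e x g))" "less_fun (lex_min_rep e g (dot e x g)) x"
      using x rep(1,2) rep(3)[of x] by auto
    then show False using less_fun_asym by blast
  qed
  moreover have "lex_min_rep e g (dot e x g) \<in> lex_apery S e g"
    unfolding lex_apery_def using x by (intro imageI) simp
  ultimately show "x \<in> lex_apery S e g" by simp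
qed

lemma apery_inj: "inj_on (\<lambda>a. a mod g 0) (apery_set S (g 0))"
proof -
  have no: False
    if a: "a \<in> apery_set S (g 0)" and b: "b \<in> apery_set S (g 0)"
      and less: "a < b" and eq: "a mod g 0 = b mod g 0" for a b
  proof -
    have "g 0 dvd b - a" using less eq by (metis mod_eq_dvd_iff_nat less_imp_le)
    then obtain k where k: "b - a = g 0 * k" by (auto elim: dvdE)
    with less obtain j where "k = Suc j" by (cases k) auto
    with k less have "b = (a + j * g 0) + g 0" by (simp add: algebra_simps)
    moreover have "a + j * g 0 \<in> S"
      using a by (intro add_mem mult_mem gen_mem e_pos) (simp add: apery_iff)
    ultimately show False using b by (auto simp: apery_iff)
  qed
  show ?thesis
  proof (rule inj_onI)
    fix a b assume "a \<in> apery_set S (g 0)" "b \<in> apery_set S (g 0)" "a mod g 0 = b mod g 0"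
    then show "a = b" using no[of a b] no[of b a] by (cases a b rule: linorder_cases) auto
  qed
qed

lemma finite_apery: "finite (apery_set S (g 0))"
proof (rule inj_on_finite[OF apery_inj])
  show "(\<lambda>a. a mod g 0) ` apery_set S (g 0) \<subseteq> {..<g 0}"
    using gen_pos[OF e_pos] by auto
qed simp

lemma zero_apery: "0 \<in> apery_set S (g 0)"
  using zero_mem gen_pos[OF e_pos] by (auto simp: apery_iff)

lemma apery_nontrivial: "apery_set S (g 0) \<noteq> {0}"
proof
  assume trivial: "apery_set S (g 0) = {0}"
  have "s \<in> S \<Longrightarrow> g 0 dvd s" for s
  proof (induction s rule: less_induct)
    case (less s)
    show ?case
    proof (cases "s = 0")
      case False
      then have "s \<notin> apery_set S (g 0)" using trivial by simp
      then obtain t where "t \<in> S" "s = t + g 0" using less.prems by (auto simp: apery_iff)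
      then show ?thesis using less.IH[of t] gen_pos[OF e_pos] by simp
    qed simp
  qed
  then have "g 0 = 1" by (intro common_divisor) blast
  then have "1 \<in> S" using gen_mem[OF e_pos] by simp
  then have "n \<in> S" for n using mult_mem[of 1 n] by simp
  then show False using proper by blast
qed

lemma admissible_weight: "admissible_weight e (\<lambda>i. of_nat (g i) / of_nat (g 0))"
  unfolding admissible_weight_def
proof (intro conjI ballI mono_onI)
  have g0: "0 < g 0" by (rule gen_pos[OF e_pos])
  have mono: "g i \<le> g j" if "i \<le> j" "j < e" for i j
    using strict that by (cases "i = j") (auto simp: strict_mono_on_def less_imp_le)
  show "1 \<le> (of_nat (g i) / of_nat (g 0) :: rat)" if "i \<in> {1..<e}" for i
    using that g0 mono[of 0 i] by simp
  show "(of_nat (g i) / of_nat (g 0) :: rat) \<le> of_nat (g j) / of_nat (g 0)"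
    if "i \<in> {1..<e}" "j \<in> {1..<e}" "i \<le> j" for i j
    using that g0 mono[of i j] by (simp add: divide_right_mono)
qed

lemma admissible_set: "admissible_set e (lex_apery S e g)"
  unfolding admissible_set_def
proof (intro conjI ballI)
  show "finite (lex_apery S e g)" by (simp add: lex_apery_def finite_apery)
  show "lex_apery S e g \<noteq> {}" using zero_apery by (auto simp: lex_apery_def)
  show "lex_apery S e g \<noteq> {\<lambda>i. 0}"
  proof
    assume zero: "lex_apery S e g = {\<lambda>i. 0}"
    have "a = 0" if a: "a \<in> apery_set S (g 0)" for a
    proof -
      have "lex_min_rep e g a \<in> lex_apery S e g" unfolding lex_apery_def using a by (rule imageI)
      then have "lex_min_rep e g a = (\<lambda>i. 0)" using zero by simp
      then show ?thesis using lex_min_rep(2)[OF a] by (simp add: dot_def)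
    qed
    then show False using apery_nontrivial zero_apery by blast
  qed
  show "lex_apery S e g \<subseteq> nvecs e" by (auto simp: lex_apery_iff)
  fix x y assume x: "x \<in> nvecs e - lex_apery S e g" and y: "y \<in> nvecs e"
  let ?z = "\<lambda>i. x i + y i"
  have "?z \<notin> lex_apery S e g"
  proof
    assume z: "?z \<in> lex_apery S e g"
    have "dot e x g \<in> apery_set S (g 0)"
    proof (rule ccontr)
      assume "dot e x g \<notin> apery_set S (g 0)"
      then obtain t where t: "t \<in> S" "dot e x g = t + g 0" using dot_mem by (auto simp: apery_iff)
      then have "dot e ?z g = (t + dot e y g) + g 0" by (simp add: dot_add)
      then show False using z add_mem[OF t(1) dot_mem] by (auto simp: lex_apery_iff apery_iff)
    qed
    note rep = lex_min_rep[OF this]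
    let ?x = "lex_min_rep e g (dot e x g)"
    have "?x \<in> lex_apery S e g"
      using \<open>dot e x g \<in> apery_set S (g 0)\<close> by (simp add: lex_apery_def)
    then have less: "less_fun ?x x" using rep(3)[of x] x by auto
    then have zless: "less_fun (\<lambda>i. ?x i + y i) ?z" by (auto simp: less_fun_def)
    have "(\<lambda>i. ?x i + y i) \<in> nvecs e" using rep(1) y by (rule nvecs_add)
    moreover have "dot e (\<lambda>i. ?x i + y i) g = dot e ?z g" using rep(2) by (simp add: dot_add)
    ultimately have "?z = (\<lambda>i. ?x i + y i) \<or> less_fun ?z (\<lambda>i. ?x i + y i)"
      using z unfolding lex_apery_iff by blast
    then show False
    proof
      assume "?z = (\<lambda>i. ?x i + y i)"
      with zless show False using less_fun_irrefl by metis
    next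
      assume "less_fun ?z (\<lambda>i. ?x i + y i)"
      with zless show False using less_fun_asym by blast
    qed
  qed
  then show "?z \<in> nvecs e - lex_apery S e g" using x y nvecs_add by blast
qed

end

end

(*
  Modulo g_0 the Apery set A meets every residue class exactly once, and in the class of a the
  elements of S are exactly those n with a <= n. Counting class by class, a contributes
  floor(a / g_0) gaps and floor((c - 1 + g_0 - a) / g_0) elements of L. Since max A = c - 1 + g_0,
  summing these two quantities over A, grouped by their values, gives the denominator and the
  numerator of w(gamma, tilde A). Wilf's inequality is rewritten with c = #L + #gaps.
*)
theory Submission
  imports Defs
begin

section \<open>Floors of quotients and sums over fibres\<close>

text \<open>Turns the rational floors defining the levels into the integer inequalities of
  \<open>H\<close> and \<open>H'\<close>. The numerator is an integer because it is later
  \<open>c + g 0 - 1 - dot e x g\<close>, which may be negative for vectors outside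
  \<open>tildeA\<close>.\<close>

lemma floor_divide_eq_iff:
  fixes m n :: int and k :: nat
  assumes "0 < k"
  shows "\<lfloor>of_int m / of_nat k :: rat\<rfloor> = n \<longleftrightarrow> n * int k \<le> m \<and> m < (n + 1) * int k"
proof -
  have "\<lfloor>of_int m / of_nat k :: rat\<rfloor> = n \<longleftrightarrow>
      (of_int n * of_nat k :: rat) \<le> of_int m \<and> (of_int m :: rat) < (of_int n + 1) * of_nat k"
    using assms by (simp add: floor_eq_iff pos_le_divide_eq pos_divide_less_eq)
  also have "\<dots> \<longleftrightarrow> (of_int (n * int k) :: rat) \<le> of_int m
      \<and> (of_int m :: rat) < of_int ((n + 1) * int k)"
    by simp
  also have "\<dots> \<longleftrightarrow> n * int k \<le> m \<and> m < (n + 1) * int k"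
    by (simp only: of_int_le_iff of_int_less_iff)
  finally show ?thesis .
qed

text \<open>Double counting: both sums in the weighted Wilf ratio run over levels, and grouping by
  \<open>f\<close> turns them into sums over the vectors themselves.\<close>

lemma sum_mult_card_fibres:
  fixes w :: "int \<Rightarrow> 'a::comm_semiring_1"
  assumes "finite B" "f ` B \<subseteq> {0..N}"
  shows "(\<Sum>n\<in>{0..N}. w n * of_nat (card {b \<in> B. f b = n})) = (\<Sum>b\<in>B. w (f b))"
proof -
  have "(\<Sum>b\<in>B. w (f b)) = (\<Sum>n\<in>{0..N}. \<Sum>b\<in>{b \<in> B. f b = n}. w (f b))"
    using assms by (intro sum.group[symmetric]) auto
  also have "\<dots> = (\<Sum>n\<in>{0..N}. w n * of_nat (card {b \<in> B. f b = n}))"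
    by (intro sum.cong) (auto simp: mult.commute)
  finally show ?thesis by simp
qed

section \<open>Existence and basic properties of the conductor\<close>

context semigroup_setup
begin

text \<open>The smallest positive difference \<open>d\<close> of two elements of \<open>S\<close>
  divides every element of \<open>S\<close>, so it is 1 by the gcd condition.\<close>

lemma consecutive_mem: obtains b where "0 < b" "b \<in> S" "Suc b \<in> S"
proof -
  let ?P = "\<lambda>d. 0 < d \<and> (\<exists>b\<in>S. b + d \<in> S)"
  define d where "d = (LEAST d. ?P d)"
  have "?P (g 0)"
    using gen_pos[OF e_pos] gen_mem[OF e_pos] zero_mem by (auto intro!: bexI[of _ 0])
  then have "?P d" unfolding d_def by (rule LeastI)
  then obtain b where b: "0 < d" "b \<in> S" "b + d \<in> S" by blast
  have "d dvd s" if s: "s \<in> S" for s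
  proof -
    \<comment> \<open>Exhibits \<open>s mod d\<close> as a difference of two elements of
      \<open>S\<close>. Being smaller than \<open>d\<close>, it must vanish.\<close>
    have "s + (s div d) * b = (s div d) * (b + d) + s mod d"
      by (simp add: algebra_simps)
    moreover have "s + (s div d) * b \<in> S" "(s div d) * (b + d) \<in> S"
      using s b by (auto intro: add_mem mult_mem)
    ultimately have "?P (s mod d)" if "s mod d \<noteq> 0" using that by auto
    moreover have "\<not> ?P (s mod d)"
      unfolding d_def by (rule not_less_Least) (use b in \<open>simp add: d_def[symmetric]\<close>)
    ultimately show ?thesis by auto
  qed
  then have "d = 1" by (intro common_divisor) blast
  \<comment> \<open>The pair found may start at 0; shifting by \<open>g 0\<close> makes its lower
    member positive.\<close>
  then have "b + g 0 \<in> S" "Suc (b + g 0) \<in> S"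
    using b gen_mem[OF e_pos] add_mem[of "b + d" "g 0"] by (auto intro: add_mem)
  then show thesis using gen_pos[OF e_pos] by (intro that[of "b + g 0"]) auto
qed

text \<open>With \<open>b\<close> and \<open>b + 1\<close> in \<open>S\<close>, write
  \<open>n\<close> as \<open>n div b\<close> copies of \<open>b\<close> plus the remainder, and
  absorb the remainder by turning \<open>n mod b\<close> of these copies into \<open>b + 1\<close>.
  There are enough copies once \<open>n\<close> is at least \<open>b * b\<close>.\<close>

lemma conductor_exists: "\<exists>s. s \<in> S \<and> (\<forall>n. s + n \<in> S)"
proof -
  obtain b where b: "0 < b" "b \<in> S" "Suc b \<in> S" by (rule consecutive_mem)
  have "n \<in> S" if "b * b \<le> n" for n
  proof -
    have "n mod b \<le> n div b"
      using b(1) div_le_mono[OF that, of b] mod_less_divisor[OF b(1), of n]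
      by (simp del: mod_less_divisor)
    then obtain q where q: "n div b = n mod b + q" using le_iff_add by blast
    have "n = (n div b) * b + n mod b" by simp
    also have "\<dots> = q * b + (n mod b) * Suc b" unfolding q by (simp add: algebra_simps)
    also have "\<dots> \<in> S" using b by (intro add_mem mult_mem)
    finally show ?thesis .
  qed
  then show ?thesis by (intro exI[of _ "b * b"]) simp
qed

lemma conductor_le_mem: "conductor S \<le> n \<Longrightarrow> n \<in> S"
  using LeastI_ex[OF conductor_exists] unfolding conductor_def[symmetric]
  by (metis le_add_diff_inverse)

lemma conductor_pos: "0 < conductor S"
  using conductor_le_mem proper by (metis UNIV_eq_I gr0I le0)

lemma conductor_pred_not_mem: "conductor S - 1 \<notin> S"
proof
  assume mem: "conductor S - 1 \<in> S"
  have "conductor S - 1 + n \<in> S" for n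
    using mem conductor_le_mem[of "conductor S - 1 + n"] by (cases n) auto
  then have "conductor S \<le> conductor S - 1"
    unfolding conductor_def using mem by (intro Least_le) (auto simp: conductor_def)
  then show False using conductor_pos by simp
qed

section \<open>Maximum and residue classes of the Apery set\<close>

lemma apery_le: "a \<in> apery_set S (g 0) \<Longrightarrow> a \<le> conductor S + g 0 - 1"
proof (rule ccontr)
  assume a: "a \<in> apery_set S (g 0)" "\<not> a \<le> conductor S + g 0 - 1"
  then have "a - g 0 \<in> S" "a = (a - g 0) + g 0" by (auto intro: conductor_le_mem)
  then show False using a(1) by (auto simp: apery_iff)
qed

text \<open>This number is at least the conductor, while subtracting \<open>g 0\<close> leaves the
  largest gap. Together with \<open>apery_le\<close> it identifies the maximum of the Apery
  set.\<close>

lemma frobenius_apery: "conductor S + g 0 - 1 \<in> apery_set S (g 0)"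
proof -
  have "conductor S + g 0 - 1 \<noteq> t + g 0" if "t \<in> S" for t
  proof
    assume "conductor S + g 0 - 1 = t + g 0"
    then have "t = conductor S - 1" using conductor_pos by simp
    then show False using that conductor_pred_not_mem by simp
  qed
  then show ?thesis
    using gen_pos[OF e_pos] by (auto simp: apery_iff intro: conductor_le_mem)
qed

text \<open>The least element of \<open>S\<close> in a residue class is an Apery element, since
  subtracting \<open>g 0\<close> would stay in the class.\<close>

lemma apery_residue:
  obtains a where "a \<in> apery_set S (g 0)" "a mod g 0 = n mod g 0"
proof -
  let ?P = "\<lambda>s. s \<in> S \<and> s mod g 0 = n mod g 0"
  define a where "a = (LEAST s. ?P s)"
  \<comment> \<open>The class meets \<open>S\<close>: adding this multiple of \<open>g 0\<close>
    keeps the residue and reaches the conductor.\<close>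
  have "n + conductor S * g 0 \<in> S"
    using gen_pos[OF e_pos] by (intro conductor_le_mem trans_le_add2) simp
  then have "?P (n + conductor S * g 0)" by simp
  then have a: "?P a" unfolding a_def by (rule LeastI)
  have "a \<noteq> t + g 0" if t: "t \<in> S" for t
  proof
    assume eq: "a = t + g 0"
    then have "?P t" using a t by simp
    then have "a \<le> t" unfolding a_def by (rule Least_le)
    then show False using eq gen_pos[OF e_pos] by simp
  qed
  then show thesis using a by (intro that[of a]) (auto simp: apery_iff)
qed

text \<open>Members of one class differ by multiples of \<open>g 0\<close>. Going up from
  \<open>a\<close> stays in \<open>S\<close>; an element of \<open>S\<close> below \<open>a\<close>
  in its class would put \<open>a - g 0\<close> into \<open>S\<close>.\<close>

lemma mem_iff_apery_le:
  assumes a: "a \<in> apery_set S (g 0)" and n: "n mod g 0 = a mod g 0"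
  shows "n \<in> S \<longleftrightarrow> a \<le> n"
proof
  assume "a \<le> n"
  then obtain k where "n = a + g 0 * k"
    using n by (metis mod_eq_nat1E)
  moreover have "a + k * g 0 \<in> S"
    using a by (intro add_mem mult_mem gen_mem e_pos) (simp add: apery_iff)
  ultimately show "n \<in> S" by (simp add: mult.commute)
next
  assume nS: "n \<in> S"
  show "a \<le> n"
  proof (rule ccontr)
    assume less: "\<not> a \<le> n"
    then obtain k where k: "a = n + g 0 * k"
      using n by (metis mod_eq_nat1E nat_le_linear)
    with less obtain j where "k = Suc j" by (cases k) auto
    with k have "a = (n + j * g 0) + g 0" by (simp add: algebra_simps)
    moreover have "n + j * g 0 \<in> S" by (intro add_mem mult_mem gen_mem e_pos nS)
    ultimately show False using a by (auto simp: apery_iff)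
  qed
qed

text \<open>The classes of the Apery elements partition the naturals: they cover by
  \<open>apery_residue\<close> and are disjoint by \<open>apery_inj\<close>.\<close>

lemma card_eq_sum_residues:
  assumes "finite X"
  shows "card X = (\<Sum>a\<in>apery_set S (g 0). card {n \<in> X. n mod g 0 = a mod g 0})"
proof -
  have "X = (\<Union>a\<in>apery_set S (g 0). {n \<in> X. n mod g 0 = a mod g 0})"
    using apery_residue by (auto; metis)
  then have "card X = card (\<Union>a\<in>apery_set S (g 0). {n \<in> X. n mod g 0 = a mod g 0})" by simp
  also have "\<dots> = (\<Sum>a\<in>apery_set S (g 0). card {n \<in> X. n mod g 0 = a mod g 0})"
    using assms finite_apery apery_inj by (intro card_UN_disjoint) (auto dest: inj_onD)
  finally show ?thesis .
qed

section \<open>Counting gaps and left elements class by class\<close>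

lemma gaps_subset: "UNIV - S \<subseteq> {..<conductor S}"
  using conductor_le_mem by (force simp: not_le[symmetric])

lemma card_gaps: "card (UNIV - S) = (\<Sum>a\<in>apery_set S (g 0). a div g 0)"
proof -
  note g0 = gen_pos[OF e_pos]
  have "card {n \<in> UNIV - S. n mod g 0 = a mod g 0} = a div g 0" if a: "a \<in> apery_set S (g 0)" for a
  proof -
    \<comment> \<open>The gaps in the class of \<open>a\<close> are its members below
      \<open>a\<close>, enumerated by their quotient \<open>k\<close>.\<close>
    have "{n \<in> UNIV - S. n mod g 0 = a mod g 0} = (\<lambda>k. a mod g 0 + k * g 0) ` {..<a div g 0}"
    proof (intro subset_antisym subsetI)
      fix n assume "n \<in> {n \<in> UNIV - S. n mod g 0 = a mod g 0}"
      then have n: "n mod g 0 = a mod g 0" "n < a" using mem_iff_apery_le[OF a] by auto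
      have "n div g 0 < a div g 0"
        using n by (metis div_le_mono div_mult_mod_eq le_antisym less_imp_le nat_neq_iff not_le)
      moreover have "n = a mod g 0 + (n div g 0) * g 0" by (simp add: n(1)[symmetric])
      ultimately show "n \<in> (\<lambda>k. a mod g 0 + k * g 0) ` {..<a div g 0}" by blast
    next
      fix n assume "n \<in> (\<lambda>k. a mod g 0 + k * g 0) ` {..<a div g 0}"
      then obtain k where k: "n = a mod g 0 + k * g 0" "k < a div g 0" by auto
      have "k * g 0 < (a div g 0) * g 0" using k(2) g0 by simp
      moreover have "a mod g 0 + (a div g 0) * g 0 = a" by simp
      ultimately have "n < a" using k(1) by linarith
      then show "n \<in> {n \<in> UNIV - S. n mod g 0 = a mod g 0}"
        using k mem_iff_apery_le[OF a, of n] by simp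
    qed
    moreover have "inj_on (\<lambda>k. a mod g 0 + k * g 0) {..<a div g 0}"
      using g0 by (auto intro: inj_onI)
    ultimately show ?thesis by (simp add: card_image)
  qed
  moreover have "finite (UNIV - S)" by (rule finite_subset[OF gaps_subset]) simp
  ultimately show ?thesis by (simp add: card_eq_sum_residues[of "UNIV - S"])
qed

lemma card_left_elements:
  "card (left_elements S) = (\<Sum>a\<in>apery_set S (g 0). (conductor S + g 0 - 1 - a) div g 0)"
proof -
  note g0 = gen_pos[OF e_pos]
  have "card {n \<in> left_elements S. n mod g 0 = a mod g 0} = (conductor S + g 0 - 1 - a) div g 0"
    if a: "a \<in> apery_set S (g 0)" for a
  proof -
    \<comment> \<open>The summand \<open>g 0 - 1\<close> rounds the quotient of
      \<open>conductor S - a\<close> up, and \<open>apery_le\<close> keeps the natural subtraction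
      from truncating. For \<open>a\<close> not below the conductor both sides are false.\<close>
    have less_iff: "k < (conductor S + g 0 - 1 - a) div g 0 \<longleftrightarrow> a + k * g 0 < conductor S" for k
    proof -
      have "k < (conductor S + g 0 - 1 - a) div g 0 \<longleftrightarrow> Suc k * g 0 \<le> conductor S + g 0 - 1 - a"
        using g0 by (simp only: Suc_le_eq[symmetric] less_eq_div_iff_mult_less_eq)
      also have "\<dots> \<longleftrightarrow> a + k * g 0 < conductor S"
        using apery_le[OF a] conductor_pos g0 by auto
      finally show ?thesis .
    qed
    have "{n \<in> left_elements S. n mod g 0 = a mod g 0} =
        (\<lambda>k. a + k * g 0) ` {..<(conductor S + g 0 - 1 - a) div g 0}"
    proof (intro subset_antisym subsetI)
      fix n assume "n \<in> {n \<in> left_elements S. n mod g 0 = a mod g 0}"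
      then have n: "n mod g 0 = a mod g 0" "a \<le> n" "n < conductor S"
        using mem_iff_apery_le[OF a] by (auto simp: left_elements_def)
      then obtain k where "n = a + k * g 0" by (metis mod_eq_nat1E mult.commute)
      then show "n \<in> (\<lambda>k. a + k * g 0) ` {..<(conductor S + g 0 - 1 - a) div g 0}"
        using n(3) less_iff by auto
    next
      fix n assume "n \<in> (\<lambda>k. a + k * g 0) ` {..<(conductor S + g 0 - 1 - a) div g 0}"
      then obtain k where "n = a + k * g 0" "a + k * g 0 < conductor S" using less_iff by auto
      then show "n \<in> {n \<in> left_elements S. n mod g 0 = a mod g 0}"
        using mem_iff_apery_le[OF a, of n] by (simp add: left_elements_def)
    qed
    moreover have "inj_on (\<lambda>k. a + k * g 0) {..<(conductor S + g 0 - 1 - a) div g 0}"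
      using g0 by (auto intro: inj_onI)
    ultimately show ?thesis by (simp add: card_image)
  qed
  moreover have "finite (left_elements S)" by (simp add: left_elements_def)
  ultimately show ?thesis by (simp add: card_eq_sum_residues[of "left_elements S"])
qed

lemma conductor_eq_card: "conductor S = card (left_elements S) + card (UNIV - S)"
proof -
  have "{..<conductor S} = left_elements S \<union> (UNIV - S)"
    using gaps_subset by (auto simp: left_elements_def)
  then have "card {..<conductor S} = card (left_elements S \<union> (UNIV - S))" by simp
  also have "\<dots> = card (left_elements S) + card (UNIV - S)"
    by (rule card_Un_disjoint) (auto simp: left_elements_def intro: finite_subset[OF gaps_subset])
  finally show ?thesis by simp
qed

lemma card_gaps_pos: "0 < card (UNIV - S)"
  using proper finite_subset[OF gaps_subset] by (auto simp: card_gt_0_iff)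

text \<open>A single generator must be 1 by the gcd condition, contradicting \<open>proper\<close>.
  This makes \<open>e - 1\<close> a positive divisor in Wilf's inequality.\<close>

lemma embedding_dimension_ge_2: "2 \<le> e"
proof (rule ccontr)
  assume "\<not> 2 \<le> e"
  then have "e = 1" using e_pos by simp
  then have S: "S = generated_by {g 0}"
    using minimal by (simp add: minimal_generating_set_def lessThan_Suc)
  have "g 0 = 1" by (intro common_divisor) (auto simp: S generated_by_def)
  then have "1 \<in> S" using gen_mem[OF e_pos] by simp
  then have "n \<in> S" for n using mult_mem[of 1 n] by simp
  then show False using proper by blast
qed

section \<open>From Apery elements to LEX-minimal vectors and their levels\<close>

text \<open>Two LEX-minimal vectors of equal value would each precede the other unless they
  coincide. The bijection carries sums over the vectors to sums over the Apery set.\<close>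

lemma bij_betw_lex_apery: "bij_betw (\<lambda>x. dot e x g) (lex_apery S e g) (apery_set S (g 0))"
  unfolding bij_betw_def
proof
  show "inj_on (\<lambda>x. dot e x g) (lex_apery S e g)"
  proof (rule inj_onI)
    fix x y assume x: "x \<in> lex_apery S e g" and y: "y \<in> lex_apery S e g"
      and eq: "dot e x g = dot e y g"
    then have "x = y \<or> less_fun x y" "y = x \<or> less_fun y x"
      unfolding lex_apery_iff by auto
    then show "x = y" using less_fun_asym by blast
  qed
  show "(\<lambda>x. dot e x g) ` lex_apery S e g = apery_set S (g 0)"
    by (force simp: lex_apery_def image_image lex_min_rep)
qed

abbreviation scaled :: "nat \<Rightarrow> rat" where
  "scaled \<equiv> \<lambda>i. of_nat (g i) / of_nat (g 0)"

lemma dot_scaled: "dot e x scaled = of_nat (dot e x g) / of_nat (g 0)"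
  by (simp add: dot_def sum_divide_distrib)

text \<open>The values on the representatives are the quotients of Apery elements by
  \<open>g 0\<close>, so the maximum comes from \<open>frobenius_apery\<close>.\<close>

lemma max_dot_scaled:
  "max_dot e scaled (lex_apery S e g) = of_nat (conductor S + g 0 - 1) / of_nat (g 0)"
proof -
  have "(\<lambda>b. dot e b scaled) ` lex_apery S e g =
      (\<lambda>a. of_nat a / of_nat (g 0)) ` (\<lambda>x. dot e x g) ` lex_apery S e g"
    by (simp add: dot_scaled image_image)
  also have "\<dots> = (\<lambda>a. of_nat a / of_nat (g 0)) ` apery_set S (g 0)"
    using bij_betw_lex_apery by (simp add: bij_betw_def)
  finally show ?thesis
    unfolding max_dot_def using finite_apery frobenius_apery gen_pos[OF e_pos]
    by (auto intro!: Max_eqI divide_right_mono dest: apery_le simp del: of_nat_diff)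
qed

lemma top_level_scaled:
  "top_level e scaled (lex_apery S e g) = int ((conductor S + g 0 - 1) div g 0)"
  by (simp only: top_level_def max_dot_scaled floor_divide_of_nat_eq of_nat_id)

lemma level_scaled:
  "level e scaled n = {x \<in> nvecs e.
     n * int (g 0) \<le> int (dot e x g) \<and> int (dot e x g) < (n + 1) * int (g 0)}"
  using floor_divide_eq_iff[OF gen_pos[OF e_pos], of "int (dot e x g)" n for x]
  by (simp add: level_def dot_scaled)

lemma level'_scaled:
  defines "N \<equiv> top_level e scaled (lex_apery S e g)"
  shows "level' e scaled (lex_apery S e g) n = {x \<in> nvecs e.
     int (conductor S) - 1 - (N - n) * int (g 0) < int (dot e x g) \<and>
     int (dot e x g) \<le> int (conductor S) - 1 - (N - n - 1) * int (g 0)}"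
proof -
  have "N - \<lfloor>max_dot e scaled (lex_apery S e g) - dot e x scaled\<rfloor> = n \<longleftrightarrow>
      int (conductor S) - 1 - (N - n) * int (g 0) < int (dot e x g) \<and>
      int (dot e x g) \<le> int (conductor S) - 1 - (N - n - 1) * int (g 0)" for x
  proof -
    \<comment> \<open>This is \<open>g 0\<close> times the distance to the maximum, taken in the
      integers because \<open>x\<close> is arbitrary here.\<close>
    let ?m = "int (conductor S) + int (g 0) - 1 - int (dot e x g)"
    have "max_dot e scaled (lex_apery S e g) - dot e x scaled = of_int ?m / of_nat (g 0)"
      using conductor_pos by (simp add: max_dot_scaled dot_scaled diff_divide_distrib of_nat_diff)
    then have "N - \<lfloor>max_dot e scaled (lex_apery S e g) - dot e x scaled\<rfloor> = n \<longleftrightarrow>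
        \<lfloor>of_int ?m / of_nat (g 0) :: rat\<rfloor> = N - n"
      by auto
    also have "\<dots> \<longleftrightarrow> (N - n) * int (g 0) \<le> ?m \<and> ?m < (N - n + 1) * int (g 0)"
      by (rule floor_divide_eq_iff[OF gen_pos[OF e_pos]])
    \<comment> \<open>Solving for \<open>dot e x g\<close> reverses the inequalities: the weak lower
      bound on \<open>?m\<close> becomes the weak upper bound, and the \<open>g 0\<close> inside
      \<open>?m\<close> shifts both factors by one.\<close>
    also have "\<dots> \<longleftrightarrow> int (conductor S) - 1 - (N - n) * int (g 0) < int (dot e x g) \<and>
      int (dot e x g) \<le> int (conductor S) - 1 - (N - n - 1) * int (g 0)"
      by (auto simp: algebra_simps)
    finally show ?thesis .
  qed
  then show ?thesis by (simp add: level'_def N_def)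
qed

section \<open>Comparison of the Wilf ratios and of Wilf's inequality\<close>

lemma wilf_ratio_eq_weighted:
  "wilf_ratio S = weighted_wilf_ratio e scaled (lex_apery S e g)"
proof -
  let ?B = "lex_apery S e g" and ?A = "apery_set S (g 0)" and ?M = "conductor S + g 0 - 1"
  define N where "N = top_level e scaled ?B"
  have N: "N = int (?M div g 0)" by (simp add: N_def top_level_scaled)
  have fin: "finite ?B" using admissible_set by (simp add: admissible_set_def)
  have sub: "?B \<subseteq> nvecs e" by (auto simp: lex_apery_iff)
  have le: "dot e x g \<le> ?M" if "x \<in> ?B" for x
    using that apery_le by (simp add: lex_apery_iff)
  have floor: "\<lfloor>dot e x scaled\<rfloor> = int (dot e x g div g 0)" for x
    by (simp only: dot_scaled floor_divide_of_nat_eq of_nat_id)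
  \<comment> \<open>On \<open>?B\<close> the value never exceeds \<open>?M\<close>, so natural
    subtraction is exact and the floor is a natural quotient.\<close>
  have floor': "\<lfloor>max_dot e scaled ?B - dot e x scaled\<rfloor> = int ((?M - dot e x g) div g 0)"
    if "x \<in> ?B" for x
  proof -
    have "max_dot e scaled ?B - dot e x scaled = of_nat (?M - dot e x g) / of_nat (g 0)"
      by (simp only: max_dot_scaled dot_scaled diff_divide_distrib of_nat_diff[OF le[OF that]])
    then show ?thesis by (simp only: floor_divide_of_nat_eq of_nat_id)
  qed
  have reindex: "(\<Sum>x\<in>?B. f (dot e x g)) = (\<Sum>a\<in>?A. f a)" for f :: "nat \<Rightarrow> rat"
    by (rule sum.reindex_bij_betw[OF bij_betw_lex_apery])
  have "(\<Sum>n\<in>{0..N}. of_int n * of_nat (level_card e scaled ?B n)) =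
      (\<Sum>n\<in>{0..N}. of_int n * of_nat (card {x \<in> ?B. int (dot e x g div g 0) = n}) :: rat)"
    by (intro sum.cong refl arg_cong2[where f = "(*)"] arg_cong[where f = of_nat])
      (use sub in \<open>auto simp: level_card_def level_def floor intro: arg_cong[where f = card]\<close>)
  also have "\<dots> = (\<Sum>x\<in>?B. of_int (int (dot e x g div g 0)))"
    by (rule sum_mult_card_fibres[OF fin]) (use le in \<open>auto simp: N intro!: div_le_mono simp del: One_nat_def\<close>)
  also have "\<dots> = of_nat (card (UNIV - S))"
    using reindex[of "\<lambda>a. of_nat (a div g 0)"] by (simp add: card_gaps)
  finally have denominator: "(\<Sum>n\<in>{0..N}. of_int n * of_nat (level_card e scaled ?B n)) =
      (of_nat (card (UNIV - S)) :: rat)" .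
  have "(\<Sum>n\<in>{0..N}. of_int (N - n) * of_nat (level_card' e scaled ?B n)) =
      (\<Sum>n\<in>{0..N}. of_int (N - n) *
        of_nat (card {x \<in> ?B. N - int ((?M - dot e x g) div g 0) = n}) :: rat)"
    by (intro sum.cong refl arg_cong2[where f = "(*)"] arg_cong[where f = of_nat])
      (use sub in \<open>auto simp: level_card'_def level'_def floor' N_def[symmetric]
        intro: arg_cong[where f = card]\<close>)
  \<comment> \<open>The decreasing weight undoes the reversed numbering of the primed levels: what
    remains is the number of left elements in the class of \<open>dot e x g\<close>.\<close>
  also have "\<dots> = (\<Sum>x\<in>?B. of_int (N - (N - int ((?M - dot e x g) div g 0))))"
    by (rule sum_mult_card_fibres[OF fin]) (auto simp: N intro!: div_le_mono)
  also have "\<dots> = of_nat (card (left_elements S))"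
    using reindex[of "\<lambda>a. of_nat ((?M - a) div g 0)"] by (simp add: card_left_elements)
  finally show ?thesis
    using denominator by (simp add: wilf_ratio_def weighted_wilf_ratio_def N_def)
qed

text \<open>Since the conductor is \<open>l + d\<close>, Wilf's inequality reads
  \<open>l + d \<le> l * e\<close>; cancelling one \<open>l\<close> and dividing by \<open>d\<close>
  and \<open>e - 1\<close>, both positive, gives the bound on the ratio.\<close>

lemma wilf_inequality_iff:
  "(of_nat (card (left_elements S)) / of_nat (conductor S) :: rat) \<ge> 1 / of_nat e
     \<longleftrightarrow> wilf_ratio S \<ge> 1 / (of_nat e - 1)"
proof -
  define l d c :: rat where "l = of_nat (card (left_elements S))"
    and "d = of_nat (card (UNIV - S))" and "c = of_nat (conductor S)"
  have c: "c = l + d" by (simp add: l_def d_def c_def conductor_eq_card)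
  have d: "d > 0" and cpos: "c > 0"
    using card_gaps_pos conductor_pos by (simp_all add: d_def c_def)
  have e: "(of_nat e :: rat) > 1" using embedding_dimension_ge_2 by simp
  have "l / c \<ge> 1 / of_nat e \<longleftrightarrow> c \<le> l * of_nat e"
    using cpos e by (simp add: field_simps)
  also have "\<dots> \<longleftrightarrow> d \<le> l * (of_nat e - 1)" by (simp add: c algebra_simps)
  also have "\<dots> \<longleftrightarrow> l / d \<ge> 1 / (of_nat e - 1)"
    using d e by (simp add: field_simps)
  finally show ?thesis by (simp add: l_def d_def c_def wilf_ratio_def)
qed

end

theorem mainTheorem4:
  fixes S :: "nat set" and e :: nat and g :: "nat \<Rightarrow> nat"
    and c :: nat and L :: "nat set" and \<gamma> :: "nat \<Rightarrow> rat" and tildeA :: "(nat \<Rightarrow> nat) set"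
    and n\<^sub>0 :: int and H H' :: "int \<Rightarrow> (nat \<Rightarrow> nat) set" and h h' :: "int \<Rightarrow> nat"
  assumes "numerical_semigroup S"
    and "S \<noteq> UNIV"
    and "strict_mono_on {..<e} g"
    and "minimal_generating_set (g ` {..<e}) S"
  defines "c \<equiv> conductor S"
    and "L \<equiv> left_elements S"
    and "\<gamma> \<equiv> (\<lambda>i. of_nat (g i) / of_nat (g 0))"
    and "tildeA \<equiv> lex_apery S e g"
    and "n\<^sub>0 \<equiv> \<lfloor>(of_nat c - 1 + of_nat (g 0)) / of_nat (g 0) :: rat\<rfloor>"
    and "H \<equiv> (\<lambda>n. {x \<in> nvecs e.
            n * int (g 0) \<le> int (dot e x g) \<and> int (dot e x g) < (n + 1) * int (g 0)})"
    and "H' \<equiv> (\<lambda>n. {x \<in> nvecs e.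
            int c - 1 - (n\<^sub>0 - n) * int (g 0) < int (dot e x g) \<and>
            int (dot e x g) \<le> int c - 1 - (n\<^sub>0 - n - 1) * int (g 0)})"
    and "h \<equiv> (\<lambda>n. card (tildeA \<inter> H n))"
    and "h' \<equiv> (\<lambda>n. card (tildeA \<inter> H' n))"
  shows "n\<^sub>0 = top_level e \<gamma> tildeA
    \<and> of_nat c + of_nat (g 0) - 1 = of_nat (g 0) * max_dot e \<gamma> tildeA
    \<and> (\<forall>n\<in>{0..n\<^sub>0}.
          H n = level e \<gamma> n \<and> h n = level_card e \<gamma> tildeA n \<and>
          H' n = level' e \<gamma> tildeA n \<and> h' n = level_card' e \<gamma> tildeA n)
    \<and> wilf_ratio S = weighted_wilf_ratio e \<gamma> tildeA
    \<and> ((of_nat (card L) / of_nat c :: rat) \<ge> 1 / of_nat e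
         \<longleftrightarrow> weighted_wilf_ratio e \<gamma> tildeA \<ge> 1 / (of_nat e - 1))"
proof -
  interpret semigroup_setup S e g by unfold_locales fact+
  \<comment> \<open>Matches the rational subtraction of the statement with the natural one of
    \<open>max_dot_scaled\<close>; they agree since \<open>c\<close> is positive.\<close>
  have M: "(of_nat c + of_nat (g 0) - 1 :: rat) = of_nat (c + g 0 - 1)"
    using conductor_pos by (simp add: c_def of_nat_diff)
  have max: "of_nat c + of_nat (g 0) - 1 = of_nat (g 0) * max_dot e \<gamma> tildeA"
    using gen_pos[OF e_pos] unfolding M by (simp add: \<gamma>_def tildeA_def max_dot_scaled c_def)
  have "(of_nat c - 1 + of_nat (g 0)) / of_nat (g 0) = max_dot e \<gamma> tildeA"
    using max gen_pos[OF e_pos] by (simp add: field_simps)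
  then have top: "n\<^sub>0 = top_level e \<gamma> tildeA" by (simp add: n\<^sub>0_def top_level_def)
  have H: "H n = level e \<gamma> n" for n by (simp add: H_def \<gamma>_def level_scaled)
  have H': "H' n = level' e \<gamma> tildeA n" for n
    \<comment> \<open>\<open>level'_scaled\<close> is phrased with \<open>top_level\<close>, so
      \<open>n\<^sub>0\<close> is replaced by it first.\<close>
    unfolding H'_def top \<gamma>_def tildeA_def c_def by (simp only: level'_scaled)
  have w: "wilf_ratio S = weighted_wilf_ratio e \<gamma> tildeA"
    by (simp add: wilf_ratio_eq_weighted \<gamma>_def tildeA_def)
  show ?thesis
    using top max w wilf_inequality_iff
    by (simp add: H H' h_def h'_def level_card_def level_card'_def L_def c_def)
qed

end
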